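(* Let $\{A(t)\}_{t\ge 0}$ be a continuous time chain of $N\times N$ matrices with state transition matrix $\Phi(t,\tau)$. For $\tau\ge0$ let $c_\tau$ be the number of vertices of the limiting polytope $C_\tau$, and let $c$ be the constant value of $c_\tau$, $\tau\ge 0$. Then $\mathbf{rank}(A)=c$ (that is, $\mathbf{rank}(A)=c_\tau$ for every $\tau\ge0$).
   Context: A continuous time chain $\{A(t)\}_{t\ge0}$ is a family of real $N\times N$ matrices with zero row sums and non-negative off-diagonal entries, whose entries are measurable and locally integrable functions of $t\in[0,\infty)$. Let $\Phi(t,\tau)$, $t\ge\tau\ge0$, be the state transition matrix of $\dot x(t)=A(t)x(t)$, so $x(t)=\Phi(t,\tau)x(\tau)$; it is invertible and row-stochastic. For $t\ge\tau\ge0$, $C_{t,\tau}\subset\mathbb R^N$ is the convex hull of the columns of the transpose $\Phi'(t,\tau)$ (i.e. of the rows of $\Phi(t,\tau)$). For fixed $\tau$ these polytopes are decreasing in $t$, and $C_\tau=\lim_{t\to\infty}C_{t,\tau}=\bigcap_{t\ge\tau}C_{t,\tau}$, which is a polytope with at most $N$ vertices (extreme points). The number $c_\tau$ of vertices of $C_\tau$ does not depend on $\tau$. Rank: for $\tau\ge0$ let $\mathbf{null}_\tau(A)=\{v\in\mathbb R^N : \lim_{t\to\infty}\Phi(t,\tau)v=\mathbf 0_N\}$. This is a vector space whose dimension does not depend on $\tau$; this dimension is $\mathbf{nullity}(A)$, and $\mathbf{rank}(A)=N-\mathbf{nullity}(A)$. *)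

theory Defs
  imports "HOL-Analysis.Analysis"
begin

text \<open>\<open>absolutely_integrable_on\<close> is Lebesgue integrability and includes Lebesgue measurability;
  on all \<open>{0..T}\<close> it is measurability plus local integrability on \<open>[0,\<infinity>)\<close>.\<close>

definition continuous_time_chain :: "(real \<Rightarrow> real^'n^'n) \<Rightarrow> bool" where
  "continuous_time_chain A \<longleftrightarrow>
     (\<forall>t\<ge>0. \<forall>i. (\<Sum>j\<in>UNIV. A t $ i $ j) = 0) \<and>
     (\<forall>t\<ge>0. \<forall>i j. i \<noteq> j \<longrightarrow> 0 \<le> A t $ i $ j) \<and>
     (\<forall>i j. \<forall>T\<ge>0. (\<lambda>t. A t $ i $ j) absolutely_integrable_on {0..T})"

text \<open>As \<open>A\<close> is only locally integrable, \<open>x' = A x\<close> is meant in the Caratheodory sense, i.e. as the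
  integral equation \<open>\<Phi>(t,\<tau>) = I + \<integral>\<^sub>\<tau>\<^sup>t A(s) \<Phi>(s,\<tau>) ds\<close>. It determines \<open>\<Phi> t \<tau>\<close> uniquely for
  \<open>t \<ge> \<tau> \<ge> 0\<close>; other values of \<open>\<Phi>\<close> are irrelevant below.\<close>

definition state_transition_matrix ::
    "(real \<Rightarrow> real^'n^'n) \<Rightarrow> (real \<Rightarrow> real \<Rightarrow> real^'n^'n) \<Rightarrow> bool" where
  "state_transition_matrix A \<Phi> \<longleftrightarrow>
     (\<forall>\<tau>\<ge>0. continuous_on {\<tau>..} (\<lambda>t. \<Phi> t \<tau>) \<and>
       (\<forall>t\<ge>\<tau>. ((\<lambda>s. A s ** \<Phi> s \<tau>) has_integral (\<Phi> t \<tau> - mat 1)) {\<tau>..t}))"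

definition polytope_at :: "(real \<Rightarrow> real \<Rightarrow> real^'n^'n) \<Rightarrow> real \<Rightarrow> real \<Rightarrow> (real^'n) set" where
  "polytope_at \<Phi> t \<tau> = convex hull (columns (transpose (\<Phi> t \<tau>)))"

definition limit_polytope :: "(real \<Rightarrow> real \<Rightarrow> real^'n^'n) \<Rightarrow> real \<Rightarrow> (real^'n) set" where
  "limit_polytope \<Phi> \<tau> = (\<Inter>t\<in>{\<tau>..}. polytope_at \<Phi> t \<tau>)"

definition num_vertices :: "(real^'n) set \<Rightarrow> nat" where
  "num_vertices C = card {x. x extreme_point_of C}"

definition null_space_at :: "(real \<Rightarrow> real \<Rightarrow> real^'n^'n) \<Rightarrow> real \<Rightarrow> (real^'n) set" where
  "null_space_at \<Phi> \<tau> = {v. ((\<lambda>t. \<Phi> t \<tau> *v v) \<longlongrightarrow> 0) at_top}"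

text \<open>The nullity and rank of a chain are expressed through its state transition matrix, which
  the chain determines. The nullity is the common value of the dimensions of the null spaces.\<close>

definition chain_nullity :: "(real \<Rightarrow> real \<Rightarrow> real^'n^'n) \<Rightarrow> nat" where
  "chain_nullity \<Phi> = (THE d. \<forall>\<tau>\<ge>0. dim (null_space_at \<Phi> \<tau>) = d)"

definition chain_rank :: "(real \<Rightarrow> real \<Rightarrow> real^'n^'n) \<Rightarrow> nat" where
  "chain_rank \<Phi> = CARD('n) - chain_nullity \<Phi>"

end

theory Submission
  imports Defs
begin

text \<open>A vector \<open>v\<close> lies in the null space exactly when it is orthogonal to the limiting polytope, so
  the rank is the dimension of the span of \<open>C\<^sub>\<tau>\<close>, and it remains to see that the vertices of
  \<open>C\<^sub>\<tau>\<close> are linearly independent. As \<open>\<Phi>(t,\<tau>)\<close> is stochastic and invertible, \<open>C\<^sub>\<tau>\<close> is a decreasing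
  intersection of simplices. Read in barycentric coordinates of these simplices, two distinct
  vertices of \<open>C\<^sub>\<tau>\<close> become mutually singular in the limit, which forbids a linear relation.

  Nonnegativity of \<open>\<Phi>\<close> comes from a minimum principle that needs no differentiability: over an
  interval on which \<open>\<integral>|A|\<close> is \<open>\<delta>\<close>, the minimal coordinate of a solution drops by at most
  \<open>O(\<delta>\<^sup>2)\<close>.\<close>

subsection \<open>The transition matrix of a chain\<close>

text \<open>The entrywise l1 norm is integrable along a chain directly because each entry is
  absolutely integrable. It dominates both the absolute row sums and the operator norm.\<close>

definition entry_sum :: "real^'n^'m \<Rightarrow> real" where
  "entry_sum M = (\<Sum>i\<in>UNIV. \<Sum>j\<in>UNIV. \<bar>M $ i $ j\<bar>)"

lemma entry_sum_nonneg: "0 \<le> entry_sum M"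
  unfolding entry_sum_def by (intro sum_nonneg) auto

lemma row_entry_sum_le: "(\<Sum>j\<in>UNIV. \<bar>M $ i $ j\<bar>) \<le> entry_sum M"
  unfolding entry_sum_def
  by (rule member_le_sum) (auto intro: sum_nonneg)

lemma norm_matrix_vector_le:
  fixes M :: "real^'n^'m"
  shows "norm (M *v w) \<le> entry_sum M * norm w"
proof -
  have "norm (M *v w) \<le> (\<Sum>i\<in>UNIV. \<bar>(M *v w) $ i\<bar>)"
    by (rule norm_le_l1_cart)
  also have "\<dots> \<le> (\<Sum>i\<in>UNIV. \<Sum>j\<in>UNIV. \<bar>M $ i $ j\<bar> * norm w)"
  proof (rule sum_mono)
    fix i
    have "\<bar>(M *v w) $ i\<bar> \<le> (\<Sum>j\<in>UNIV. \<bar>M $ i $ j * w $ j\<bar>)"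
      unfolding matrix_vector_mult_def by (simp add: sum_abs)
    also have "\<dots> \<le> (\<Sum>j\<in>UNIV. \<bar>M $ i $ j\<bar> * norm w)"
      by (intro sum_mono) (simp add: abs_mult mult_left_mono component_le_norm_cart)
    finally show "\<bar>(M *v w) $ i\<bar> \<le> (\<Sum>j\<in>UNIV. \<bar>M $ i $ j\<bar> * norm w)" .
  qed
  also have "\<dots> = entry_sum M * norm w"
    by (simp add: entry_sum_def sum_distrib_right)
  finally show ?thesis .
qed

text \<open>The integral equation is required on every subinterval, so a solution can be restarted
  at any later time; \<open>solution_fromI\<close> reduces this to intervals starting at
  \<tau>.\<close>

definition solution_from :: "(real \<Rightarrow> real^'n^'n) \<Rightarrow> real \<Rightarrow> (real \<Rightarrow> real^'n) \<Rightarrow> bool" where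
  "solution_from A \<tau> x \<longleftrightarrow> continuous_on {\<tau>..} x \<and>
     (\<forall>u\<ge>\<tau>. \<forall>v\<ge>u. ((\<lambda>s. A s *v x s) has_integral (x v - x u)) {u..v})"

lemma solution_fromI:
  assumes "continuous_on {\<tau>..} x"
    and x: "\<And>t. \<tau> \<le> t \<Longrightarrow> ((\<lambda>s. A s *v x s) has_integral (x t - x \<tau>)) {\<tau>..t}"
  shows "solution_from A \<tau> x"
proof -
  have "((\<lambda>s. A s *v x s) has_integral (x v - x u)) {u..v}" if "\<tau> \<le> u" "u \<le> v" for u v
  proof -
    have "(\<lambda>s. A s *v x s) integrable_on {\<tau>..v}"
      using x[of v] that by auto
    then have "(\<lambda>s. A s *v x s) integrable_on {u..v}"
      using that by (elim integrable_subinterval_real) auto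
    then obtain k where k: "((\<lambda>s. A s *v x s) has_integral k) {u..v}" by auto
    have "((\<lambda>s. A s *v x s) has_integral ((x u - x \<tau>) + k)) {\<tau>..v}"
      using that by (intro has_integral_combine[OF _ _ x k]) auto
    then have "x u - x \<tau> + k = x v - x \<tau>"
      by (rule has_integral_unique) (use x[of v] that in simp)
    then have "k = x v - x u" by (simp add: algebra_simps)
    with k show ?thesis by simp
  qed
  with assms(1) show ?thesis by (simp add: solution_from_def)
qed

lemma solution_from_diff:
  assumes "solution_from A \<tau> x" "solution_from A \<tau> y"
  shows "solution_from A \<tau> (\<lambda>t. x t - y t)"
proof -
  have "((\<lambda>s. A s *v (x s - y s)) has_integral (x v - y v) - (x u - y u)) {u..v}"
    if "\<tau> \<le> u" "u \<le> v" for u v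
    using has_integral_diff[of "\<lambda>s. A s *v x s" "x v - x u" "{u..v}" "\<lambda>s. A s *v y s" "y v - y u"]
      assms that unfolding solution_from_def
    by (simp add: algebra_simps)
  then show ?thesis
    using assms by (simp add: solution_from_def continuous_on_diff)
qed

lemma solution_from_later:
  "solution_from A \<tau> x \<Longrightarrow> \<tau> \<le> s \<Longrightarrow> solution_from A s x"
  unfolding solution_from_def by (auto intro: continuous_on_subset)

section \<open>Growth, uniqueness and the minimum principle for solutions\<close>

locale chain =
  fixes A :: "real \<Rightarrow> real^'n^'n"
  assumes chain: "continuous_time_chain A"
begin

lemma row_sum_zero: "0 \<le> t \<Longrightarrow> (\<Sum>j\<in>UNIV. A t $ i $ j) = 0"
  and off_diagonal_nonneg: "0 \<le> t \<Longrightarrow> i \<noteq> j \<Longrightarrow> 0 \<le> A t $ i $ j"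
  using chain by (auto simp: continuous_time_chain_def)

text \<open>The time scale adapted to \<open>A\<close>: a bounded solution is Lipschitz in
  \<open>clock\<close>, although it need not be so in \<open>t\<close>.\<close>

definition clock :: "real \<Rightarrow> real" where
  "clock t = integral {0..t} (\<lambda>s. entry_sum (A s))"

lemma entry_sum_integrable: "(\<lambda>s. entry_sum (A s)) integrable_on {0..t}"
proof (cases "0 \<le> t")
  case True
  then have "(\<lambda>s. \<bar>A s $ i $ j\<bar>) integrable_on {0..t}" for i j
    using chain by (auto simp: continuous_time_chain_def absolutely_integrable_on_def)
  then show ?thesis
    unfolding entry_sum_def by (intro integrable_sum) auto
qed auto

lemma has_integral_clock:
  assumes "0 \<le> u" "u \<le> v"
  shows "((\<lambda>s. entry_sum (A s)) has_integral (clock v - clock u)) {u..v}"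
proof -
  have "(\<lambda>s. entry_sum (A s)) integrable_on {u..v}"
    using entry_sum_integrable[of v] assms by (elim integrable_subinterval_real) auto
  moreover have "clock v = clock u + integral {u..v} (\<lambda>s. entry_sum (A s))"
    unfolding clock_def using assms
    by (intro Henstock_Kurzweil_Integration.integral_combine[symmetric] entry_sum_integrable) auto
  ultimately show ?thesis
    by (simp add: has_integral_iff)
qed

lemma clock_mono: "0 \<le> u \<Longrightarrow> u \<le> v \<Longrightarrow> clock u \<le> clock v"
  using has_integral_nonneg[OF has_integral_clock] entry_sum_nonneg by fastforce

lemma continuous_on_clock: "continuous_on {0..T} clock"
  unfolding clock_def
  by (intro indefinite_integral_continuous_1 entry_sum_integrable)

lemma solution_increment_bound:
  assumes "solution_from A \<tau> x" "0 \<le> \<tau>" "\<tau> \<le> u" "u \<le> v"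
    and M: "\<And>s. s \<in> {u..v} \<Longrightarrow> norm (x s) \<le> M"
  shows "norm (x v - x u) \<le> M * (clock v - clock u)"
proof -
  have x: "((\<lambda>s. A s *v x s) has_integral (x v - x u)) {u..v}"
    using assms by (simp add: solution_from_def)
  have g: "((\<lambda>s. M * entry_sum (A s)) has_integral M * (clock v - clock u)) {u..v}"
    using assms by (intro has_integral_mult_right has_integral_clock) auto
  have "norm (integral {u..v} (\<lambda>s. A s *v x s)) \<le> integral {u..v} (\<lambda>s. M * entry_sum (A s))"
  proof (rule integral_norm_bound_integral)
    fix s assume "s \<in> {u..v}"
    then have "norm (A s *v x s) \<le> entry_sum (A s) * M"
      by (meson M entry_sum_nonneg mult_left_mono norm_matrix_vector_le order_trans)
    then show "norm (A s *v x s) \<le> M * entry_sum (A s)"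
      by (simp add: mult.commute)
  qed (use x g in auto)
  then show ?thesis
    unfolding integral_unique[OF x] integral_unique[OF g] .
qed

text \<open>The zero set is closed and relatively open in a connected interval. The zero
  \<open>c\<close> may lie on either side of \<open>t\<close>, so uniqueness holds backwards in time
  as well; this is what yields invertibility.\<close>

lemma solution_eq_zero:
  assumes x: "solution_from A \<tau> x" and "0 \<le> \<tau>"
    and c: "c \<in> {\<tau>..T}" "x c = 0" and t: "t \<in> {\<tau>..T}"
  shows "x t = 0"
proof -
  have cont: "continuous_on {\<tau>..T} x"
    using x by (auto simp: solution_from_def intro: continuous_on_subset)
  have "openin (top_of_set {\<tau>..T}) {t \<in> {\<tau>..T}. x t = 0}"
    unfolding openin_contains_ball
  proof (intro conjI ballI)
    fix t0 assume "t0 \<in> {t \<in> {\<tau>..T}. x t = 0}"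
    then have t0: "t0 \<in> {\<tau>..T}" "x t0 = 0" by auto
    have "continuous_on {\<tau>..T} clock"
      using continuous_on_clock[of T] by (rule continuous_on_subset) (use \<open>0 \<le> \<tau>\<close> in auto)
    then obtain d where d: "d > 0"
      "\<And>s. s \<in> {\<tau>..T} \<Longrightarrow> dist s t0 < d \<Longrightarrow> dist (clock s) (clock t0) < 1/2"
      using t0(1) unfolding continuous_on_iff by (metis half_gt_zero_iff zero_less_one)
    \<comment> \<open>The closed ball of half the radius gives a compact interval on which the clock
      still differs from \<open>clock t0\<close> by less than 1/2.\<close>
    define I where "I = cball t0 (d/2) \<inter> {\<tau>..T}"
    have I: "I = {max (t0 - d/2) \<tau>..min (t0 + d/2) T}"
      unfolding I_def cball_eq_atLeastAtMost by auto
    have "t0 \<in> I" using t0 d(1) by (auto simp: I_def)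
    have "\<exists>s\<in>I. \<forall>r\<in>I. norm (x r) \<le> norm (x s)"
    proof (rule continuous_attains_sup)
      show "compact I" unfolding I by simp
      show "I \<noteq> {}" using \<open>t0 \<in> I\<close> by auto
      show "continuous_on I (\<lambda>s. norm (x s))"
        by (intro continuous_on_norm continuous_on_subset[OF cont]) (auto simp: I_def)
    qed
    then obtain s where s: "s \<in> I" "\<And>r. r \<in> I \<Longrightarrow> norm (x r) \<le> norm (x s)" by auto
    have close: "\<bar>clock s - clock t0\<bar> < 1/2"
    proof -
      have "dist s t0 < d" using s(1) d(1) by (simp add: I_def dist_commute)
      then show ?thesis using d(2)[of s] s(1) by (auto simp: I_def dist_real_def)
    qed
    \<comment> \<open>Since \<open>x t0 = 0\<close> and \<open>s\<close> maximises the norm on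
      \<open>I\<close>, the increment bound between \<open>t0\<close> and \<open>s\<close> compares
      this maximum with less than half of itself unless it is zero.\<close>
    have "norm (x s) \<le> norm (x s) * \<bar>clock s - clock t0\<bar>"
    proof (cases "t0 \<le> s")
      case True
      have "norm (x s - x t0) \<le> norm (x s) * (clock s - clock t0)"
        by (rule solution_increment_bound[OF x \<open>0 \<le> \<tau>\<close>])
           (use True s \<open>t0 \<in> I\<close> I in auto)
      also have "\<dots> \<le> norm (x s) * \<bar>clock s - clock t0\<bar>"
        by (intro mult_left_mono) auto
      finally show ?thesis using t0(2) by simp
    next
      case False
      have "norm (x t0 - x s) \<le> norm (x s) * (clock t0 - clock s)"
        by (rule solution_increment_bound[OF x \<open>0 \<le> \<tau>\<close>])
           (use False s \<open>t0 \<in> I\<close> I in auto)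
      also have "\<dots> \<le> norm (x s) * \<bar>clock s - clock t0\<bar>"
        by (intro mult_left_mono) auto
      finally show ?thesis using t0(2) by simp
    qed
    also have "\<dots> \<le> norm (x s) * (1/2)"
      using close by (intro mult_left_mono) auto
    finally have "norm (x s) = 0" by simp
    then have "\<And>r. r \<in> I \<Longrightarrow> x r = 0" using s(2) by fastforce
    then show "\<exists>e>0. ball t0 e \<inter> {\<tau>..T} \<subseteq> {t \<in> {\<tau>..T}. x t = 0}"
      using d(1) by (intro exI[of _ "d/2"]) (auto simp: I_def)
  qed auto
  then have "\<forall>t\<in>{\<tau>..T}. x t = 0"
    by (rule continuous_levelset_openin[OF connected_Icc cont]) (use c in auto)
  with t show ?thesis by blast
qed

text \<open>Freeze the solution at \<open>x u\<close>. The off-diagonal terms then push upwards, and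
  the diagonal term pulls down in proportion to the margin \<open>x u $ i - m\<close>, too weakly to
  use it up while the clock increment is at most 1. Replacing \<open>x s\<close> by
  \<open>x u\<close> costs \<open>M * ?G\<close> per unit of clock, a second-order error after
  integration.\<close>

lemma minimum_step:
  assumes x: "solution_from A \<tau> x" and "0 \<le> \<tau>" "\<tau> \<le> u" "u \<le> v" "clock v - clock u \<le> 1"
    and M: "\<And>s. s \<in> {u..v} \<Longrightarrow> norm (x s) \<le> M"
    and m: "\<And>i. m \<le> x u $ i"
  shows "m - M * (clock v - clock u)^2 \<le> x v $ i"
proof -
  let ?G = "clock v - clock u"
  have "0 \<le> M" using order_trans[OF norm_ge_zero M[of u]] \<open>u \<le> v\<close> by simp
  have "0 \<le> ?G" using assms clock_mono by simp
  have lower: "- ((x u $ i - m) + M * ?G) * entry_sum (A s) \<le> (A s *v x s) $ i"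
    if s: "s \<in> {u..v}" for s
  proof -
    have "0 \<le> s" using s assms by auto
    have "norm (x s - x u) \<le> M * (clock s - clock u)"
      by (rule solution_increment_bound[OF x]) (use s assms in auto)
    also have "\<dots> \<le> M * ?G"
      using s assms \<open>0 \<le> M\<close> by (intro mult_left_mono diff_right_mono clock_mono) auto
    finally have diff: "\<bar>x s $ j - x u $ j\<bar> \<le> M * ?G" for j
      using component_le_norm_cart[of "x s - x u" j] by simp
    have "- (x u $ i - m) * entry_sum (A s) \<le> A s $ i $ i * (x u $ i - m)"
    proof -
      have "\<bar>A s $ i $ i\<bar> \<le> (\<Sum>j\<in>UNIV. \<bar>A s $ i $ j\<bar>)"
        by (rule member_le_sum) auto
      then have "- A s $ i $ i \<le> entry_sum (A s)"
        using row_entry_sum_le[of "A s" i] by linarith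
      then have "- A s $ i $ i * (x u $ i - m) \<le> entry_sum (A s) * (x u $ i - m)"
        using m[of i] by (intro mult_right_mono) auto
      then show ?thesis by (simp add: algebra_simps)
    qed
    also have "A s $ i $ i * (x u $ i - m) \<le> (\<Sum>j\<in>UNIV. A s $ i $ j * (x u $ j - m))"
    proof -
      have "0 \<le> (\<Sum>j\<in>UNIV - {i}. A s $ i $ j * (x u $ j - m))"
        using m \<open>0 \<le> s\<close> off_diagonal_nonneg by (intro sum_nonneg mult_nonneg_nonneg) auto
      then show ?thesis by (subst sum.remove[of _ i]) auto
    qed
    finally have 1: "- (x u $ i - m) * entry_sum (A s) \<le> (\<Sum>j\<in>UNIV. A s $ i $ j * (x u $ j - m))" .
    have "\<bar>\<Sum>j\<in>UNIV. A s $ i $ j * (x s $ j - x u $ j)\<bar> \<le> (\<Sum>j\<in>UNIV. \<bar>A s $ i $ j\<bar> * (M * ?G))"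
      by (rule order_trans[OF sum_abs], rule sum_mono) (simp add: abs_mult mult_left_mono diff)
    also have "\<dots> \<le> entry_sum (A s) * (M * ?G)"
      unfolding sum_distrib_right[symmetric]
      using \<open>0 \<le> M\<close> \<open>0 \<le> ?G\<close> by (intro mult_right_mono row_entry_sum_le) auto
    finally have 2: "- (entry_sum (A s) * (M * ?G)) \<le> (\<Sum>j\<in>UNIV. A s $ i $ j * (x s $ j - x u $ j))"
      by linarith
    have "(A s *v x s) $ i = (\<Sum>j\<in>UNIV. A s $ i $ j * (x s $ j - m))"
    proof -
      have "(\<Sum>j\<in>UNIV. A s $ i $ j * (x s $ j - m))
          = (\<Sum>j\<in>UNIV. A s $ i $ j * x s $ j) - (\<Sum>j\<in>UNIV. A s $ i $ j) * m"
        by (simp add: right_diff_distrib sum_subtractf sum_distrib_right)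
      then show ?thesis
        using row_sum_zero[OF \<open>0 \<le> s\<close>] by (simp add: matrix_vector_mult_def)
    qed
    also have "\<dots> = (\<Sum>j\<in>UNIV. A s $ i $ j * (x u $ j - m))
        + (\<Sum>j\<in>UNIV. A s $ i $ j * (x s $ j - x u $ j))"
      by (simp add: sum.distrib[symmetric] algebra_simps)
    finally show ?thesis using 1 2 by (simp add: algebra_simps)
  qed
  have "((\<lambda>s. A s *v x s) has_integral (x v - x u)) {u..v}"
    using x assms by (simp add: solution_from_def)
  from has_integral_linear[OF this bounded_linear_vec_nth[of i]]
  have "((\<lambda>s. (A s *v x s) $ i) has_integral x v $ i - x u $ i) {u..v}"
    by (simp add: o_def)
  moreover have "((\<lambda>s. - ((x u $ i - m) + M * ?G) * entry_sum (A s)) has_integral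
      - ((x u $ i - m) + M * ?G) * ?G) {u..v}"
    using assms by (intro has_integral_mult_right has_integral_clock) auto
  ultimately have "- ((x u $ i - m) + M * ?G) * ?G \<le> x v $ i - x u $ i"
    by (intro has_integral_le[OF _ _ lower])
  \<comment> \<open>Here the bound 1 on the clock increment enters: the diagonal loss does not
    exceed the margin.\<close>
  moreover have "(x u $ i - m) * ?G \<le> x u $ i - m"
    using m[of i] assms by (simp add: mult_left_le)
  ultimately show ?thesis
    by (simp add: algebra_simps power2_eq_square)
qed

text \<open>Halving the clock increment halves the total quadratic error, so iterating removes it.\<close>

lemma minimum_principle:
  assumes x: "solution_from A \<tau> x" and "0 \<le> \<tau>" "\<tau> \<le> T" and m: "\<And>i. m \<le> x \<tau> $ i"
  shows "m \<le> x T $ i"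
proof -
  have "compact (x ` {\<tau>..T})"
    using x by (intro compact_continuous_image) (auto simp: solution_from_def intro: continuous_on_subset)
  then obtain M where M: "\<And>s. s \<in> {\<tau>..T} \<Longrightarrow> norm (x s) \<le> M"
    using compact_imp_bounded bounded_iff by (metis image_eqI)
  have "0 \<le> M" using order_trans[OF norm_ge_zero M[of \<tau>]] \<open>\<tau> \<le> T\<close> by simp
  \<comment> \<open>The bound \<open>m\<close> varies in the induction because the second half
    starts from a lowered bound. The factor 2 covers the base case with clock increment above 1,
    where coordinates of modulus at most \<open>M\<close> can drop by at most
    \<open>2 * M\<close>.\<close>
  have halving: "\<forall>i. m - 2 * M * (clock v - clock u)^2 / 2^n \<le> x v $ i"
    if "u \<in> {\<tau>..T}" "v \<in> {\<tau>..T}" "u \<le> v" "\<And>i. m \<le> x u $ i" for u v m n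
    using that
  proof (induction n arbitrary: u v m)
    case 0
    let ?G = "clock v - clock u"
    show ?case
    proof (cases "?G \<le> 1")
      case True
      have "m - M * ?G^2 \<le> x v $ i" for i
        by (rule minimum_step[OF x \<open>0 \<le> \<tau>\<close>]) (use 0 True M in auto)
      moreover have "M * ?G^2 \<le> 2 * M * ?G^2" using \<open>0 \<le> M\<close> by simp
      ultimately have "m - 2 * M * ?G^2 \<le> x v $ i" for i by (meson diff_left_mono order_trans)
      then show ?thesis by simp
    next
      case False
      have G: "2 * M * 1 \<le> 2 * M * ?G^2"
        using False \<open>0 \<le> M\<close> by (intro mult_left_mono one_le_power) auto
      have "m - 2 * M * ?G^2 \<le> x v $ i" for i
        using 0(4)[of i] component_le_norm_cart[of "x u" i] component_le_norm_cart[of "x v" i]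
          M[OF 0(1)] M[OF 0(2)] G by linarith
      then show ?thesis by simp
    qed
  next
    case (Suc n)
    have "continuous_on {u..v} clock"
      using continuous_on_clock[of v] by (rule continuous_on_subset) (use Suc.prems \<open>0 \<le> \<tau>\<close> in auto)
    moreover have "clock u \<le> clock v" using Suc.prems \<open>0 \<le> \<tau>\<close> clock_mono by simp
    \<comment> \<open>The interval is split at the midpoint of the clock, not of time.\<close>
    ultimately obtain w where w: "u \<le> w" "w \<le> v" "clock w = (clock u + clock v) / 2"
      using IVT'[of clock u "(clock u + clock v) / 2" v] Suc.prems by auto
    let ?E = "2 * M * ((clock v - clock u)/2)^2 / 2^n"
    have half: "clock w - clock u = (clock v - clock u) / 2" "clock v - clock w = (clock v - clock u) / 2"
      using w(3) by (auto simp: field_simps)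
    have "\<forall>i. m - ?E \<le> x w $ i"
      using Suc.IH[of u w m, unfolded half] Suc.prems w(1,2) by auto
    then have *: "\<forall>i. m - ?E - ?E \<le> x v $ i"
      using Suc.IH[of w v "m - ?E", unfolded half] Suc.prems w(1,2) by auto
    have "m - ?E - ?E = m - 2 * M * (clock v - clock u)^2 / 2^Suc n"
      by (simp add: power_divide field_simps)
    with * show ?case by metis
  qed
  have "(\<lambda>n. m - 2 * M * (clock T - clock \<tau>)^2 / 2^n) \<longlonglongrightarrow> m - 0"
    by (intro tendsto_diff tendsto_const LIMSEQ_divide_realpow_zero) auto
  then have "m - 0 \<le> x T $ i"
    by (rule LIMSEQ_le_const2) (use halving[of \<tau> T m] m \<open>\<tau> \<le> T\<close> in auto)
  then show ?thesis by simp
qed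

end

section \<open>Stochasticity, composition and invertibility of the transition matrix\<close>

locale chain_transition = chain A for A :: "real \<Rightarrow> real^'n^'n" +
  fixes \<Phi> :: "real \<Rightarrow> real \<Rightarrow> real^'n^'n"
  assumes transition: "state_transition_matrix A \<Phi>"
begin

lemma transition_refl: "0 \<le> \<tau> \<Longrightarrow> \<Phi> \<tau> \<tau> = mat 1"
  using transition has_integral_unique[OF _ has_integral_refl(2)]
  by (fastforce simp: state_transition_matrix_def)

text \<open>Applying a matrix to a fixed vector is bounded linear in the matrix, hence commutes with
  the integral.\<close>

lemma solution_transition:
  assumes "0 \<le> \<tau>"
  shows "solution_from A \<tau> (\<lambda>t. \<Phi> t \<tau> *v w)"
proof (rule solution_fromI)
  have lin: "bounded_linear (\<lambda>X. X *v w :: real^'n)"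
    by (rule linear_conv_bounded_linear[THEN iffD1], rule linearI)
       (simp_all add: matrix_vector_mult_add_rdistrib scaleR_matrix_vector_assoc)
  show "continuous_on {\<tau>..} (\<lambda>t. \<Phi> t \<tau> *v w)"
    using transition assms
    by (intro bounded_linear.continuous_on[OF lin]) (auto simp: state_transition_matrix_def)
  fix t assume "\<tau> \<le> t"
  then have "((\<lambda>s. A s ** \<Phi> s \<tau>) has_integral (\<Phi> t \<tau> - mat 1)) {\<tau>..t}"
    using transition assms by (simp add: state_transition_matrix_def)
  from has_integral_linear[OF this lin]
  show "((\<lambda>s. A s *v (\<Phi> s \<tau> *v w)) has_integral \<Phi> t \<tau> *v w - \<Phi> \<tau> \<tau> *v w) {\<tau>..t}"
    using assms by (simp add: o_def transition_refl matrix_vector_mul_assoc matrix_vector_mult_diff_rdistrib)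
qed

text \<open>Column \<open>j\<close> is the solution starting at the non-negative vector
  \<open>axis j 1\<close>.\<close>

lemma transition_nonneg:
  assumes "0 \<le> \<tau>" "\<tau> \<le> t"
  shows "0 \<le> \<Phi> t \<tau> $ i $ j"
proof -
  have "0 \<le> (\<Phi> t \<tau> *v axis j 1) $ i"
    by (rule minimum_principle[OF solution_transition])
       (use assms in \<open>auto simp: transition_refl axis_def\<close>)
  then show ?thesis by (simp add: matrix_vector_mult_basis column_def)
qed

text \<open>The minimum principle for the constant vectors 1 and -1 gives the two
  inequalities.\<close>

lemma transition_row_sum:
  assumes "0 \<le> \<tau>" "\<tau> \<le> t"
  shows "(\<Sum>j\<in>UNIV. \<Phi> t \<tau> $ i $ j) = 1"
proof -
  have "c \<le> (\<Phi> t \<tau> *v (\<chi> k. c)) $ i" for c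
    by (rule minimum_principle[OF solution_transition])
       (use assms in \<open>auto simp: transition_refl\<close>)
  from this[of 1] this[of "-1"] show ?thesis
    by (simp add: matrix_vector_mult_def sum_negf)
qed

text \<open>Applied to a vector, both sides solve the equation from \<open>s\<close> on and agree at
  \<open>s\<close>, so uniqueness applies to their difference.\<close>

lemma transition_compose:
  assumes "0 \<le> \<tau>" "\<tau> \<le> s" "s \<le> t"
  shows "\<Phi> t \<tau> = \<Phi> t s ** \<Phi> s \<tau>"
proof -
  have "\<Phi> t \<tau> *v w - \<Phi> t s *v (\<Phi> s \<tau> *v w) = 0" for w
  proof (rule solution_eq_zero[where x = "\<lambda>t. \<Phi> t \<tau> *v w - \<Phi> t s *v (\<Phi> s \<tau> *v w)"])
    show "solution_from A s (\<lambda>t. \<Phi> t \<tau> *v w - \<Phi> t s *v (\<Phi> s \<tau> *v w))"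
      using assms
      by (intro solution_from_diff solution_transition solution_from_later[OF solution_transition]) auto
    show "s \<in> {s..t}" "t \<in> {s..t}" using assms by auto
  qed (use assms in \<open>auto simp: transition_refl\<close>)
  then show ?thesis
    by (auto simp: matrix_eq matrix_vector_mul_assoc)
qed

text \<open>Uniqueness run backwards: a solution vanishing at \<open>t\<close> vanishes at \<tau>,
  where it equals \<open>w\<close>.\<close>

lemma transition_inj:
  assumes "0 \<le> \<tau>" "\<tau> \<le> t"
  shows "inj ((*v) (\<Phi> t \<tau>))"
proof -
  have "w = 0" if "\<Phi> t \<tau> *v w = 0" for w
  proof -
    have "\<Phi> \<tau> \<tau> *v w = 0"
      by (rule solution_eq_zero[OF solution_transition, where c=t and T=t])
         (use assms that in auto)
    then show ?thesis using assms by (simp add: transition_refl)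
  qed
  then show ?thesis
    using linear_inj_iff_eq_0[OF matrix_vector_mul_linear] by blast
qed

lemma transition_inverse:
  assumes "0 \<le> \<tau>" "\<tau> \<le> t"
  obtains Q where "Q ** \<Phi> t \<tau> = mat 1" "\<Phi> t \<tau> ** Q = mat 1"
  using transition_inj[OF assms] invertible_left_inverse matrix_left_invertible_injective
  by (metis matrix_left_right_inverse)

end

subsection \<open>Nested simplices\<close>

lemma row_eq_axis_mult: "row i P = axis i 1 v* (P :: real^'n^'m)"
  by (simp add: vec_eq_iff row_def vector_matrix_mult_def axis_def if_distrib if_distribR cong: if_cong)

lemma vector_matrix_eq_sum_rows: "q v* (P :: real^'n^'m) = (\<Sum>i\<in>UNIV. q $ i *\<^sub>R row i P)"
  by (simp add: vec_eq_iff row_def vector_matrix_mult_def mult.commute)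

text \<open>The right-hand side is convex and contains row \<open>i\<close>, with coefficient vector
  \<open>axis i 1\<close>; conversely each \<open>q v* P\<close> is a convex combination of
  rows.\<close>

lemma convex_hull_rows:
  fixes P :: "real^'n^'m"
  shows "convex hull rows P = {q v* P | q. (\<forall>i. 0 \<le> q $ i) \<and> (\<Sum>i\<in>UNIV. q $ i) = 1}"
    (is "_ = ?S")
proof
  show "convex hull rows P \<subseteq> ?S"
  proof (rule hull_minimal)
    show "rows P \<subseteq> ?S"
    proof
      fix p assume "p \<in> rows P"
      then obtain i where "p = axis i 1 v* P" by (auto simp: rows_def row_eq_axis_mult)
      moreover have "\<forall>j. 0 \<le> axis i (1::real) $ j" "(\<Sum>j\<in>UNIV. axis i (1::real) $ j) = 1"
        by (simp_all add: axis_def)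
      ultimately show "p \<in> ?S" by blast
    qed
    show "convex ?S"
    proof (rule convexI, clarify)
      fix q r :: "real^'m" and u v :: real
      assume "0 \<le> u" "0 \<le> v" "u + v = 1" "\<forall>i. 0 \<le> q $ i" "\<forall>i. 0 \<le> r $ i"
        "(\<Sum>i\<in>UNIV. q $ i) = 1" "(\<Sum>i\<in>UNIV. r $ i) = 1"
      then show "\<exists>p. u *\<^sub>R (q v* P) + v *\<^sub>R (r v* P) = p v* P \<and> (\<forall>i. 0 \<le> p $ i) \<and>
          (\<Sum>i\<in>UNIV. p $ i) = 1"
        by (intro exI[of _ "u *\<^sub>R q + v *\<^sub>R r"])
           (simp add: vector_matrix_left_distrib scaleR_vector_matrix_assoc sum.distrib
              flip: sum_distrib_left)
    qed
  qed
  show "?S \<subseteq> convex hull rows P"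
  proof clarify
    fix q :: "real^'m"
    assume "\<forall>i. 0 \<le> q $ i" "(\<Sum>i\<in>UNIV. q $ i) = 1"
    then show "q v* P \<in> convex hull rows P"
      unfolding vector_matrix_eq_sum_rows
      by (intro convex_sum convex_convex_hull hull_inc) (auto simp: rows_def)
  qed
qed

lemma sum_vector_stochastic_mult:
  fixes P :: "real^'n^'m"
  assumes "\<And>i. (\<Sum>j\<in>UNIV. P $ i $ j) = 1"
  shows "(\<Sum>j\<in>UNIV. (q v* P) $ j) = (\<Sum>i\<in>UNIV. q $ i)"
proof -
  have "(\<Sum>j\<in>UNIV. (q v* P) $ j) = (\<Sum>j\<in>UNIV. \<Sum>i\<in>UNIV. P $ i $ j * q $ i)"
    by (simp add: vector_matrix_mult_def mult.commute)
  also have "\<dots> = (\<Sum>i\<in>UNIV. \<Sum>j\<in>UNIV. P $ i $ j * q $ i)"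
    by (rule sum.swap)
  also have "\<dots> = (\<Sum>i\<in>UNIV. q $ i)"
    by (simp add: assms flip: sum_distrib_right)
  finally show ?thesis .
qed

text \<open>If some \<open>Y a\<close> reaches \<open>X\<close>, its term alone suffices because
  \<open>b a\<close> is at least 1; otherwise every minimum is \<open>Y a\<close> and nothing has
  changed.\<close>

lemma le_sum_min:
  fixes X :: real
  assumes "finite t" "0 \<le> X" "\<And>a. a \<in> t \<Longrightarrow> 0 \<le> Y a" "\<And>a. a \<in> t \<Longrightarrow> 1 \<le> b a"
    and X: "X \<le> (\<Sum>a\<in>t. b a * Y a)"
  shows "X \<le> (\<Sum>a\<in>t. b a * min X (Y a))"
proof (cases "\<exists>a\<in>t. X \<le> Y a")
  case True
  then obtain a where a: "a \<in> t" "X \<le> Y a" by auto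
  have "X = 1 * min X (Y a)" using a by simp
  also have "\<dots> \<le> b a * min X (Y a)"
    using assms a by (intro mult_right_mono) auto
  also have "\<dots> \<le> (\<Sum>a\<in>t. b a * min X (Y a))"
  proof (rule member_le_sum)
    fix c assume "c \<in> t - {a}"
    then have "0 \<le> b c" "0 \<le> min X (Y c)"
      using assms(2,3) assms(4)[of c] by auto
    then show "0 \<le> b c * min X (Y c)" by simp
  qed (use assms(1) a in auto)
  finally show ?thesis .
next
  case False
  then have "(\<Sum>a\<in>t. b a * min X (Y a)) = (\<Sum>a\<in>t. b a * Y a)"
    by (intro sum.cong) (auto simp: min_def)
  with X show ?thesis by simp
qed

text \<open>Models the transition matrices at times \<tau> + n together with their inverses:
  \<open>p v* Q n\<close> is the vector of barycentric coordinates of \<open>p\<close> in the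
  simplex spanned by the rows of \<open>P n\<close>.\<close>

locale nested_simplices =
  fixes P Q :: "nat \<Rightarrow> real^'n^'n"
  assumes PQ: "P n ** Q n = mat 1" and QP: "Q n ** P n = mat 1"
    and nonneg: "0 \<le> P n $ i $ j"
    and row_sum: "(\<Sum>j\<in>UNIV. P n $ i $ j) = 1"
    and nested: "convex hull rows (P (Suc n)) \<subseteq> convex hull rows (P n)"
begin

text \<open>The cone over the n-th simplex. Working with cones allows a point to be split into
  summands without normalising them; the simplex is the slice of mass 1.\<close>

definition cone_at :: "nat \<Rightarrow> (real^'n) set" where
  "cone_at n = {p. \<forall>i. 0 \<le> (p v* Q n) $ i}"

definition mass :: "real^'n \<Rightarrow> real" where
  "mass p = (\<Sum>i\<in>UNIV. p $ i)"

definition limit_cone :: "(real^'n) set" where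
  "limit_cone = (\<Inter>n. cone_at n)"

definition limit_simplex :: "(real^'n) set" where
  "limit_simplex = (\<Inter>n. convex hull rows (P n))"

lemma mult_Q_P: "p v* Q n v* P n = p"
  by (simp add: vector_matrix_mul_assoc QP)

lemma mult_P_Q: "p v* P n v* Q n = p"
  by (simp add: vector_matrix_mul_assoc PQ)

lemma mass_P: "mass (p v* P n) = mass p"
  unfolding mass_def by (intro sum_vector_stochastic_mult row_sum)

lemma mass_Q: "mass (p v* Q n) = mass p"
  by (metis mass_P mult_Q_P)

lemma mass_diff: "mass (p - q) = mass p - mass q"
  and mass_scaleR: "mass (c *\<^sub>R p) = c * mass p"
  by (simp_all add: mass_def sum_subtractf sum_distrib_left)

text \<open>Stochastic matrices and their inverses preserve mass, so the barycentric coordinates of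
  \<open>p\<close> sum to \<open>mass p\<close>.\<close>

lemma hull_rows_iff: "p \<in> convex hull rows (P n) \<longleftrightarrow> p \<in> cone_at n \<and> mass p = 1"
proof
  assume "p \<in> convex hull rows (P n)"
  then show "p \<in> cone_at n \<and> mass p = 1"
    by (auto simp: convex_hull_rows cone_at_def mult_P_Q mass_P) (simp add: mass_def)
next
  assume p: "p \<in> cone_at n \<and> mass p = 1"
  then have "mass (p v* Q n) = 1" by (simp add: mass_Q)
  with p show "p \<in> convex hull rows (P n)"
    unfolding convex_hull_rows cone_at_def
    by (auto intro!: exI[of _ "p v* Q n"] simp: mult_Q_P mass_def)
qed

lemma cone_at_scaleR: "0 \<le> c \<Longrightarrow> p \<in> cone_at n \<Longrightarrow> c *\<^sub>R p \<in> cone_at n"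
  by (simp add: cone_at_def scaleR_vector_matrix_assoc)

lemma zero_mass_eq_zero:
  assumes "p \<in> cone_at n" "mass p = 0"
  shows "p = 0"
proof -
  have "\<forall>i. (p v* Q n) $ i = 0"
    using assms mass_Q[of p n] sum_nonneg_eq_0_iff[of UNIV "\<lambda>i. (p v* Q n) $ i"]
    by (auto simp: cone_at_def mass_def)
  then have "p v* Q n = 0" by (simp add: vec_eq_iff)
  then show ?thesis by (metis mult_Q_P vector_matrix_mult_0)
qed

lemma mass_nonneg: "p \<in> cone_at n \<Longrightarrow> 0 \<le> mass p"
  unfolding mass_Q[of p n, symmetric] by (auto simp: mass_def cone_at_def intro: sum_nonneg)

text \<open>Nesting is given for simplices only, so a nonzero point is scaled to mass 1 and
  back.\<close>

lemma cone_at_decreasing: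
  assumes "m \<le> n"
  shows "cone_at n \<subseteq> cone_at m"
  using assms
proof (induction n rule: dec_induct)
  case (step n)
  have "p \<in> cone_at n" if p: "p \<in> cone_at (Suc n)" for p
  proof (cases "mass p = 0")
    case True
    with p have "p = 0" by (rule zero_mass_eq_zero)
    then show ?thesis by (simp add: cone_at_def)
  next
    case False
    with mass_nonneg[OF p] have pos: "0 < mass p" by simp
    with p have "(1 / mass p) *\<^sub>R p \<in> convex hull rows (P (Suc n))"
      by (simp add: hull_rows_iff cone_at_scaleR mass_scaleR)
    with nested have "(1 / mass p) *\<^sub>R p \<in> cone_at n"
      using hull_rows_iff by blast
    then have "mass p *\<^sub>R (1 / mass p) *\<^sub>R p \<in> cone_at n"
      by (rule cone_at_scaleR[OF less_imp_le[OF pos]])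
    moreover have "mass p *\<^sub>R (1 / mass p) *\<^sub>R p = p" using pos by simp
    ultimately show ?thesis by metis
  qed
  with step show ?case by blast
qed simp

lemma closed_cone_at: "closed (cone_at n)"
proof -
  have lin: "linear (\<lambda>p. p v* Q n)"
    by (rule linearI) (simp_all add: vector_matrix_left_distrib scaleR_vector_matrix_assoc)
  show ?thesis
    unfolding cone_at_def
    by (intro closed_Collect_all closed_Collect_le continuous_intros linear_continuous_on_compose[OF _ lin])
qed

lemma limit_simplex_iff: "p \<in> limit_simplex \<longleftrightarrow> p \<in> limit_cone \<and> mass p = 1"
  by (auto simp: limit_simplex_def limit_cone_def hull_rows_iff)

text \<open>Extreme points span extreme rays of the limit cone: normalising \<open>p\<close> and
  \<open>x - p\<close> exhibits \<open>x\<close> as their convex combination with weights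
  \<open>mass p\<close> and \<open>1 - mass p\<close>. If one weight is 0, that part is itself
  zero.\<close>

lemma extreme_point_dominates:
  assumes x: "x extreme_point_of limit_simplex"
    and p: "p \<in> limit_cone" "x - p \<in> limit_cone"
  shows "p = mass p *\<^sub>R x"
proof -
  have mx: "mass x = 1"
    using x by (simp add: extreme_point_of_def limit_simplex_iff)
  let ?s = "mass p"
  have "0 \<le> ?s" using p(1) mass_nonneg by (auto simp: limit_cone_def)
  have "0 \<le> mass (x - p)" using p(2) mass_nonneg by (auto simp: limit_cone_def)
  then have "?s \<le> 1" by (simp add: mass_diff mx)
  consider "?s = 0" | "?s = 1" | "0 < ?s" "?s < 1"
    using \<open>0 \<le> ?s\<close> \<open>?s \<le> 1\<close> by linarith
  then show ?thesis
  proof cases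
    case 1
    then have "p = 0" using p(1) zero_mass_eq_zero by (auto simp: limit_cone_def)
    with 1 show ?thesis by simp
  next
    case 2
    then have "mass (x - p) = 0" by (simp add: mass_diff mx)
    moreover have "x - p \<in> cone_at 0" using p(2) by (simp add: limit_cone_def)
    ultimately have "x - p = 0" by (intro zero_mass_eq_zero)
    with 2 show ?thesis by simp
  next
    case 3
    let ?a = "(1 / ?s) *\<^sub>R p" and ?b = "(1 / (1 - ?s)) *\<^sub>R (x - p)"
    have "?a \<in> limit_simplex" "?b \<in> limit_simplex"
      using 3 p by (auto simp: limit_simplex_iff limit_cone_def mass_scaleR mass_diff mx
          intro!: cone_at_scaleR)
    \<comment> \<open>The unsimplified weight matches the form of \<open>in_segment\<close> with
      parameter \<open>1 - ?s\<close>.\<close>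
    moreover have "x = (1 - (1 - ?s)) *\<^sub>R ?a + (1 - ?s) *\<^sub>R ?b"
      using 3 by simp
    ultimately have "?a = ?b"
      using x 3 by (metis extreme_point_of_def in_segment(2) diff_gt_0_iff_gt diff_less_eq less_add_same_cancel1)
    with \<open>x = _\<close> have "x = ?a"
      by (metis add.commute diff_add_cancel scaleR_left_distrib scaleR_one)
    then have "?s *\<^sub>R x = ?s *\<^sub>R ?a" by simp
    with 3 show ?thesis by simp
  qed
qed

text \<open>The common part of two probability vectors, in barycentric coordinates of the n-th
  simplex; its mass tending to 0 expresses mutual singularity in the limit.\<close>

definition overlap :: "real^'n \<Rightarrow> real^'n \<Rightarrow> nat \<Rightarrow> real^'n" where
  "overlap x y n = (\<chi> i. min ((x v* Q n) $ i) ((y v* Q n) $ i))"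

text \<open>A limit of the common parts would be a multiple of both extreme points.\<close>

lemma overlap_tendsto_zero:
  assumes x: "x extreme_point_of limit_simplex" and y: "y extreme_point_of limit_simplex"
    and "x \<noteq> y"
  shows "(\<lambda>n. mass (overlap x y n)) \<longlonglongrightarrow> 0"
proof (rule ccontr)
  assume not_zero: "\<not> ?thesis"
  have xS: "x \<in> limit_cone" "mass x = 1" and yS: "y \<in> limit_cone" "mass y = 1"
    using x y by (auto simp: extreme_point_of_def limit_simplex_iff)
  have ov_nonneg: "0 \<le> overlap x y n $ i" for n i
    using xS yS by (simp add: overlap_def limit_cone_def cone_at_def)
  \<comment> \<open>The overlap as a point of the ambient space, where values for different
    \<open>n\<close> can be compared; it is dominated by both \<open>x\<close> and \<open>y\<close>
    in the n-th cone.\<close>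
  define c where "c n = overlap x y n v* P n" for n
  have c_cone: "c n \<in> cone_at n" for n
    using ov_nonneg by (simp add: c_def cone_at_def mult_P_Q)
  have xc_cone: "x - c n \<in> cone_at n" and yc_cone: "y - c n \<in> cone_at n" for n
    by (auto simp: c_def cone_at_def vector_matrix_mult_diff_distrib mult_P_Q overlap_def)
  have mass_c: "mass (c n) = mass (overlap x y n)" for n
    by (simp add: c_def mass_P)
  have c_box: "c n \<in> cbox 0 1" for n
  proof -
    have c0: "0 \<le> c n $ i" for i
      using ov_nonneg nonneg by (auto simp: c_def vector_matrix_mult_def intro!: sum_nonneg)
    have "c n $ i \<le> mass (c n)" for i
      unfolding mass_def using c0 by (intro member_le_sum) auto
    moreover have "mass (c n) \<le> 1"
      using mass_nonneg[OF xc_cone[of n]] xS by (simp add: mass_diff)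
    ultimately have "c n $ i \<le> 1" for i by (meson order_trans)
    with c0 show ?thesis by (simp add: mem_box_cart)
  qed
  obtain e where "0 < e" and "\<not> (\<exists>N. \<forall>n\<ge>N. \<bar>mass (c n)\<bar> < e)"
    using not_zero by (auto simp: LIMSEQ_iff mass_c)
  then have "\<forall>N. \<exists>n\<ge>N. e \<le> mass (c n)"
    using mass_nonneg[OF c_cone] by (simp add: not_less)
  \<comment> \<open>If the masses do not tend to 0, some of size at least \<open>e\<close> occur
    arbitrarily late; compactness of the box then provides a limit \<open>l\<close>.\<close>
  then obtain h where h: "\<And>N. N \<le> h N" "\<And>N. e \<le> mass (c (h N))" by metis
  have "seq_compact (cbox (0::real^'n) 1)"
    by (intro compact_imp_seq_compact compact_cbox)
  moreover have "\<forall>k. c (h k) \<in> cbox 0 1" using c_box by blast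
  ultimately obtain l r where "l \<in> cbox 0 1" and r: "strict_mono (r :: nat \<Rightarrow> nat)"
    and "((\<lambda>k. c (h k)) \<circ> r) \<longlonglongrightarrow> l"
    by (rule seq_compactE)
  then have l: "(\<lambda>k. c (h (r k))) \<longlonglongrightarrow> l" by (simp add: o_def)
  have late: "N \<le> h (r k)" if "N \<le> k" for N k
    using that h(1)[of "r k"] seq_suble[OF r, of k] by linarith
  \<comment> \<open>The cones are closed and decreasing, so a limit of points from ever later cones
    lies in all of them.\<close>
  have in_cone: "z \<in> limit_cone"
    if z: "(\<lambda>k. f (h (r k))) \<longlonglongrightarrow> z" and f: "\<And>n. f n \<in> cone_at n" for z f
  proof -
    have "z \<in> cone_at N" for N
    proof (rule Lim_in_closed_set[OF closed_cone_at _ _ z])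
      have "f (h (r k)) \<in> cone_at N" if "N \<le> k" for k
        using f cone_at_decreasing[OF late[OF that]] by blast
      then show "\<forall>\<^sub>F k in sequentially. f (h (r k)) \<in> cone_at N"
        by (rule eventually_sequentiallyI)
    qed simp
    then show ?thesis by (simp add: limit_cone_def)
  qed
  have lims: "l \<in> limit_cone" "x - l \<in> limit_cone" "y - l \<in> limit_cone"
    by (rule in_cone[where f=c], fact l, fact c_cone,
        rule in_cone[where f="\<lambda>n. x - c n"], intro tendsto_intros l, fact xc_cone,
        rule in_cone[where f="\<lambda>n. y - c n"], intro tendsto_intros l, fact yc_cone)
  have "(\<lambda>k. mass (c (h (r k)))) \<longlonglongrightarrow> mass l"
    unfolding mass_def by (intro tendsto_intros l)
  then have "e \<le> mass l"
    by (rule LIMSEQ_le_const) (use h in auto)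
  then have "mass l \<noteq> 0" using \<open>0 < e\<close> by simp
  moreover have "mass l *\<^sub>R x = mass l *\<^sub>R y"
    using extreme_point_dominates[OF x] extreme_point_dominates[OF y] lims by metis
  ultimately show False using \<open>x \<noteq> y\<close> by simp
qed

text \<open>In a relation expressing \<open>x\<close> by other extreme points, each barycentric
  coordinate of \<open>x\<close> is bounded by a fixed combination of its overlaps with them.
  Summing coordinates bounds the mass 1 of \<open>x\<close> by a quantity tending to 0.\<close>

lemma independent_extreme_points: "independent {x. x extreme_point_of limit_simplex}"
proof
  assume "dependent {x. x extreme_point_of limit_simplex}"
  then obtain x where x: "x extreme_point_of limit_simplex"
    and "x \<in> span ({x. x extreme_point_of limit_simplex} - {x})"
    unfolding dependent_def by auto
  then obtain t r where t: "finite t" "t \<subseteq> {x. x extreme_point_of limit_simplex} - {x}"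
    and xr: "x = (\<Sum>a\<in>t. r a *\<^sub>R a)"
    unfolding span_explicit by auto
  have cone: "0 \<le> (y v* Q n) $ i" if "y extreme_point_of limit_simplex" for y n i
    using that by (auto simp: extreme_point_of_def limit_simplex_iff limit_cone_def cone_at_def)
  have "mass x = 1" using x by (simp add: extreme_point_of_def limit_simplex_iff)
  have bound: "1 \<le> (\<Sum>a\<in>t. (1 + \<bar>r a\<bar>) * mass (overlap x a n))" for n
  proof -
    have lin: "linear (\<lambda>p. p v* Q n)"
      by (rule linearI) (simp_all add: vector_matrix_left_distrib scaleR_vector_matrix_assoc)
    have comp: "(x v* Q n) $ i \<le> (\<Sum>a\<in>t. (1 + \<bar>r a\<bar>) * overlap x a n $ i)" for i
    proof -
      have "(x v* Q n) $ i = (\<Sum>a\<in>t. r a * (a v* Q n) $ i)"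
        by (subst xr) (simp add: linear_sum[OF lin] scaleR_vector_matrix_assoc)
      \<comment> \<open>The weight \<open>1 + \<bar>r a\<bar>\<close> dominates \<open>r a\<close>
        and is at least 1, as \<open>le_sum_min\<close> requires.\<close>
      also have "\<dots> \<le> (\<Sum>a\<in>t. (1 + \<bar>r a\<bar>) * (a v* Q n) $ i)"
        using t cone by (intro sum_mono mult_right_mono) auto
      finally have "(x v* Q n) $ i \<le> (\<Sum>a\<in>t. (1 + \<bar>r a\<bar>) * (a v* Q n) $ i)" .
      then have "(x v* Q n) $ i \<le> (\<Sum>a\<in>t. (1 + \<bar>r a\<bar>) * min ((x v* Q n) $ i) ((a v* Q n) $ i))"
        by (intro le_sum_min) (use t cone x in auto)
      then show ?thesis by (simp add: overlap_def)
    qed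
    have "1 = (\<Sum>i\<in>UNIV. (x v* Q n) $ i)"
      using mass_Q[of x n] \<open>mass x = 1\<close> by (simp add: mass_def)
    also have "\<dots> \<le> (\<Sum>i\<in>UNIV. \<Sum>a\<in>t. (1 + \<bar>r a\<bar>) * overlap x a n $ i)"
      by (intro sum_mono comp)
    also have "\<dots> = (\<Sum>a\<in>t. (1 + \<bar>r a\<bar>) * mass (overlap x a n))"
      unfolding mass_def sum_distrib_left by (rule sum.swap)
    finally show ?thesis .
  qed
  have "(\<lambda>n. \<Sum>a\<in>t. (1 + \<bar>r a\<bar>) * mass (overlap x a n)) \<longlonglongrightarrow> (\<Sum>a\<in>t. (1 + \<bar>r a\<bar>) * 0)"
    using t x by (intro tendsto_intros overlap_tendsto_zero) auto
  then have "1 \<le> (\<Sum>a\<in>t. (1 + \<bar>r a\<bar>) * 0)"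
    by (rule LIMSEQ_le_const) (use bound in auto)
  then show False by simp
qed

end

subsection \<open>The limiting polytope and the null space\<close>

context chain_transition
begin

text \<open>By composition, coefficients \<open>q\<close> at time \<open>t\<close> become
  \<open>q v* \<Phi> t s\<close> at time \<open>s\<close>, again a probability vector because
  \<open>\<Phi> t s\<close> is stochastic.\<close>

lemma polytope_at_decreasing:
  assumes "0 \<le> \<tau>" "\<tau> \<le> s" "s \<le> t"
  shows "polytope_at \<Phi> t \<tau> \<subseteq> polytope_at \<Phi> s \<tau>"
proof
  fix p assume "p \<in> polytope_at \<Phi> t \<tau>"
  then obtain q where p: "p = q v* \<Phi> t \<tau>" and q: "\<And>i. 0 \<le> q $ i" "(\<Sum>i\<in>UNIV. q $ i) = 1"
    by (auto simp: polytope_at_def convex_hull_rows)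
  have "p = (q v* \<Phi> t s) v* \<Phi> s \<tau>"
    using assms by (simp add: p transition_compose[of \<tau> s t] vector_matrix_mul_assoc)
  moreover have "0 \<le> (q v* \<Phi> t s) $ i" for i
    using assms q by (auto simp: vector_matrix_mult_def transition_nonneg intro!: sum_nonneg)
  moreover have "(\<Sum>i\<in>UNIV. (q v* \<Phi> t s) $ i) = 1"
    using assms q by (subst sum_vector_stochastic_mult) (auto simp: transition_row_sum)
  ultimately show "p \<in> polytope_at \<Phi> s \<tau>"
    unfolding polytope_at_def columns_transpose convex_hull_rows by blast
qed

lemma limit_polytope_eq_INT_nat:
  assumes "0 \<le> \<tau>"
  shows "limit_polytope \<Phi> \<tau> = (\<Inter>n. polytope_at \<Phi> (\<tau> + real n) \<tau>)"
proof
  show "(\<Inter>n. polytope_at \<Phi> (\<tau> + real n) \<tau>) \<subseteq> limit_polytope \<Phi> \<tau>"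
    unfolding limit_polytope_def
  proof (rule INT_greatest)
    fix t assume "t \<in> {\<tau>..}"
    moreover obtain n where "t - \<tau> \<le> real n" using real_arch_simple by blast
    ultimately have "polytope_at \<Phi> (\<tau> + real n) \<tau> \<subseteq> polytope_at \<Phi> t \<tau>"
      using assms by (intro polytope_at_decreasing) auto
    then show "(\<Inter>n. polytope_at \<Phi> (\<tau> + real n) \<tau>) \<subseteq> polytope_at \<Phi> t \<tau>" by blast
  qed
qed (auto simp: limit_polytope_def)

lemma compact_polytope_at: "compact (polytope_at \<Phi> t \<tau>)"
  unfolding polytope_at_def columns_transpose
  by (intro compact_convex_hull finite_imp_compact) (simp add: rows_def full_SetCompr_eq)

lemma compact_limit_polytope: "compact (limit_polytope \<Phi> \<tau>)"
  unfolding limit_polytope_def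
  by (intro compact_Inter) (auto simp: compact_polytope_at)

lemma convex_limit_polytope: "convex (limit_polytope \<Phi> \<tau>)"
  unfolding limit_polytope_def polytope_at_def by (intro convex_INT convex_convex_hull)

lemma independent_vertices:
  assumes "0 \<le> \<tau>"
  shows "independent {x. x extreme_point_of limit_polytope \<Phi> \<tau>}"
proof -
  have "\<forall>n. \<exists>Q. Q ** \<Phi> (\<tau> + real n) \<tau> = mat 1 \<and> \<Phi> (\<tau> + real n) \<tau> ** Q = mat 1"
    using assms by (metis le_add_same_cancel1 of_nat_0_le_iff transition_inverse)
  then obtain Q where Q: "\<And>n. Q n ** \<Phi> (\<tau> + real n) \<tau> = mat 1"
    "\<And>n. \<Phi> (\<tau> + real n) \<tau> ** Q n = mat 1" by metis
  interpret nested_simplices "\<lambda>n. \<Phi> (\<tau> + real n) \<tau>" Q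
  proof
    fix n
    show "convex hull rows (\<Phi> (\<tau> + real (Suc n)) \<tau>) \<subseteq> convex hull rows (\<Phi> (\<tau> + real n) \<tau>)"
      using polytope_at_decreasing[of \<tau> "\<tau> + real n" "\<tau> + real (Suc n)"] assms
      by (simp add: polytope_at_def)
  qed (use assms Q in \<open>auto simp: transition_nonneg transition_row_sum\<close>)
  have "limit_polytope \<Phi> \<tau> = limit_simplex"
    using assms by (simp add: limit_polytope_eq_INT_nat limit_simplex_def polytope_at_def)
  then show ?thesis using independent_extreme_points by simp
qed

text \<open>For \<open>x\<close> in the limit, \<open>x \<bullet> v\<close> is at every time a
  convex combination of the coordinates of \<open>\<Phi> t \<tau> *v v\<close>. Conversely these
  coordinates are inner products of \<open>v\<close> with rows, which lie in polytopes shrinking to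
  the limit.\<close>

lemma null_space_at_eq_orthogonal:
  assumes "0 \<le> \<tau>"
  shows "null_space_at \<Phi> \<tau> = {v. \<forall>x\<in>limit_polytope \<Phi> \<tau>. orthogonal x v}"
proof (intro equalityI subsetI CollectI ballI)
  fix v x assume "v \<in> null_space_at \<Phi> \<tau>" and x: "x \<in> limit_polytope \<Phi> \<tau>"
  then have v: "((\<lambda>t. \<Phi> t \<tau> *v v) \<longlongrightarrow> 0) at_top" by (simp add: null_space_at_def)
  have "\<bar>x \<bullet> v\<bar> \<le> (\<Sum>i\<in>UNIV. \<bar>(\<Phi> t \<tau> *v v) $ i\<bar>)" if "\<tau> \<le> t" for t
  proof -
    have "x \<in> polytope_at \<Phi> t \<tau>" using x that by (auto simp: limit_polytope_def)
    then obtain q where xq: "x = q v* \<Phi> t \<tau>" and q: "\<And>i. 0 \<le> q $ i" "(\<Sum>i\<in>UNIV. q $ i) = 1"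
      by (auto simp: polytope_at_def convex_hull_rows)
    have "q $ i \<le> 1" for i
      unfolding q(2)[symmetric] using q(1) by (intro member_le_sum) auto
    have "x \<bullet> v = (\<Sum>i\<in>UNIV. q $ i * (\<Phi> t \<tau> *v v) $ i)"
      unfolding xq dot_lmul_matrix by (simp add: inner_vec_def)
    also have "\<bar>\<dots>\<bar> \<le> (\<Sum>i\<in>UNIV. \<bar>q $ i * (\<Phi> t \<tau> *v v) $ i\<bar>)" by (rule sum_abs)
    also have "\<dots> \<le> (\<Sum>i\<in>UNIV. 1 * \<bar>(\<Phi> t \<tau> *v v) $ i\<bar>)"
      unfolding abs_mult using q \<open>\<And>i. q $ i \<le> 1\<close> by (intro sum_mono mult_right_mono) auto
    finally show ?thesis by simp
  qed
  then have ev: "\<forall>\<^sub>F t in at_top. \<bar>x \<bullet> v\<bar> \<le> (\<Sum>i\<in>UNIV. \<bar>(\<Phi> t \<tau> *v v) $ i\<bar>)"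
    by (auto simp: eventually_at_top_linorder)
  have "((\<lambda>t. \<Sum>i\<in>UNIV. \<bar>(\<Phi> t \<tau> *v v) $ i\<bar>) \<longlongrightarrow> (\<Sum>i\<in>UNIV. \<bar>(0::real^'n) $ i\<bar>)) at_top"
    by (intro tendsto_intros v)
  then have "\<bar>x \<bullet> v\<bar> \<le> (\<Sum>i\<in>UNIV. \<bar>(0::real^'n) $ i\<bar>)"
    using ev by (rule tendsto_lowerbound) simp
  then show "orthogonal x v" by (simp add: orthogonal_def)
next
  fix v assume "v \<in> {v. \<forall>x\<in>limit_polytope \<Phi> \<tau>. orthogonal x v}"
  then have v: "x \<bullet> v = 0" if "x \<in> limit_polytope \<Phi> \<tau>" for x
    using that by (simp add: orthogonal_def)
  have "((\<lambda>t. (\<Phi> t \<tau> *v v) $ i) \<longlongrightarrow> 0) at_top" for i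
  proof (rule tendstoI)
    fix e :: real assume "0 < e"
    \<comment> \<open>Nested compact sets whose intersection is empty because \<open>v\<close> is
      orthogonal to the limit; hence one of them is empty, and all later rows have inner product
      below \<open>e\<close> with \<open>v\<close>.\<close>
    define D where "D n = polytope_at \<Phi> (\<tau> + real n) \<tau> \<inter> {x. e \<le> \<bar>x \<bullet> v\<bar>}" for n
    have "\<exists>n. D n = {}"
    proof (rule ccontr)
      assume "\<nexists>n. D n = {}"
      then have "\<Inter> (range D) \<noteq> {}"
      proof (intro compact_nest)
        show "compact (D n)" for n
          unfolding D_def
          by (intro compact_Int_closed compact_polytope_at closed_Collect_le continuous_intros)
        show "D n \<subseteq> D m" if "m \<le> n" for m n
          using that assms polytope_at_decreasing[of \<tau> "\<tau> + real m" "\<tau> + real n"]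
          by (auto simp: D_def)
      qed auto
      then obtain x where "\<And>n. x \<in> D n" by auto
      then have "x \<in> limit_polytope \<Phi> \<tau>" "e \<le> \<bar>x \<bullet> v\<bar>"
        using assms by (auto simp: limit_polytope_eq_INT_nat D_def)
      with v \<open>0 < e\<close> show False by simp
    qed
    then obtain n where n: "D n = {}" by auto
    have "dist ((\<Phi> t \<tau> *v v) $ i) 0 < e" if t: "\<tau> + real n \<le> t" for t
    proof -
      have "row i (\<Phi> t \<tau>) \<in> polytope_at \<Phi> t \<tau>"
        by (auto simp: polytope_at_def rows_def intro!: hull_inc)
      then have "row i (\<Phi> t \<tau>) \<in> polytope_at \<Phi> (\<tau> + real n) \<tau>"
        using t assms polytope_at_decreasing[of \<tau> "\<tau> + real n" t] by auto
      with n have "\<bar>row i (\<Phi> t \<tau>) \<bullet> v\<bar> < e" by (auto simp: D_def)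
      moreover have "row i (\<Phi> t \<tau>) \<bullet> v = (\<Phi> t \<tau> *v v) $ i"
        by (simp add: row_def inner_vec_def matrix_vector_mult_def)
      ultimately show ?thesis by simp
    qed
    then show "\<forall>\<^sub>F t in at_top. dist ((\<Phi> t \<tau> *v v) $ i) 0 < e"
      by (auto simp: eventually_at_top_linorder)
  qed
  then show "v \<in> null_space_at \<Phi> \<tau>"
    unfolding null_space_at_def by (auto intro: vec_tendstoI)
qed

text \<open>By Krein-Milman the vertices span the same space as the polytope, of dimension their
  number by independence; the null space is its orthogonal complement.\<close>

lemma dim_null_space_at:
  assumes "0 \<le> \<tau>"
  shows "dim (null_space_at \<Phi> \<tau>) + card {x. x extreme_point_of limit_polytope \<Phi> \<tau>} = CARD('n)"
proof -
  let ?C = "limit_polytope \<Phi> \<tau>"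
  let ?E = "{x. x extreme_point_of ?C}"
  have "?C = convex hull ?E"
    by (rule Krein_Milman_Minkowski[OF compact_limit_polytope convex_limit_polytope])
  then have "?C \<subseteq> span ?E"
    using convex_hull_subset_span by metis
  moreover have "?E \<subseteq> ?C" by (auto simp: extreme_point_of_def)
  ultimately have "span ?C = span ?E"
    by (simp add: span_eq span_base subset_iff)
  then have "dim (span ?C) = card ?E"
    using dim_span_eq_card_independent[OF independent_vertices[OF assms]] by simp
  moreover have "null_space_at \<Phi> \<tau> = {y \<in> UNIV. \<forall>x\<in>span ?C. orthogonal x y}"
    unfolding null_space_at_eq_orthogonal[OF assms]
    by (auto simp: span_base) (metis orthogonal_commute orthogonal_to_span)
  ultimately show ?thesis
    using dim_subspace_orthogonal_to_vectors[of "span ?C" UNIV] by simp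
qed

text \<open>The invertible matrix \<open>\<Phi> \<tau> 0\<close> carries the null space at 0 onto
  the one at \<tau>, by composition. This makes the definite description in
  \<open>chain_nullity\<close> meaningful.\<close>

lemma dim_null_space_at_eq:
  assumes "0 \<le> \<tau>"
  shows "dim (null_space_at \<Phi> \<tau>) = dim (null_space_at \<Phi> 0)"
proof -
  obtain Q where Q: "\<Phi> \<tau> 0 ** Q = mat 1"
    using transition_inverse[OF order_refl assms] by metis
  have iff: "\<Phi> \<tau> 0 *v w \<in> null_space_at \<Phi> \<tau> \<longleftrightarrow> w \<in> null_space_at \<Phi> 0" for w
  proof -
    have "\<Phi> t \<tau> *v (\<Phi> \<tau> 0 *v w) = \<Phi> t 0 *v w" if "\<tau> \<le> t" for t
      using transition_compose[OF order_refl assms that] by (simp add: matrix_vector_mul_assoc)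
    then have "\<forall>\<^sub>F t in at_top. \<Phi> t \<tau> *v (\<Phi> \<tau> 0 *v w) = \<Phi> t 0 *v w"
      by (auto simp: eventually_at_top_linorder)
    then show ?thesis
      unfolding null_space_at_def mem_Collect_eq by (rule tendsto_cong)
  qed
  have "null_space_at \<Phi> \<tau> = (*v) (\<Phi> \<tau> 0) ` null_space_at \<Phi> 0"
  proof (intro equalityI subsetI)
    fix v assume v: "v \<in> null_space_at \<Phi> \<tau>"
    have "v = \<Phi> \<tau> 0 *v (Q *v v)" by (simp add: matrix_vector_mul_assoc Q)
    moreover from this v have "Q *v v \<in> null_space_at \<Phi> 0"
      using iff[of "Q *v v"] by simp
    ultimately show "v \<in> (*v) (\<Phi> \<tau> 0) ` null_space_at \<Phi> 0" by (rule image_eqI)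
  qed (auto simp: iff)
  moreover have "inj_on ((*v) (\<Phi> \<tau> 0)) (span (null_space_at \<Phi> 0))"
    using transition_inj[OF order_refl assms] by (rule inj_on_subset) simp
  ultimately show ?thesis
    by (simp add: dim_image_eq[OF matrix_vector_mul_linear])
qed

lemma chain_nullity_eq: "chain_nullity \<Phi> = dim (null_space_at \<Phi> 0)"
  unfolding chain_nullity_def
proof (rule the_equality)
  show "\<forall>\<tau>\<ge>0. dim (null_space_at \<Phi> \<tau>) = dim (null_space_at \<Phi> 0)"
    by (intro allI impI dim_null_space_at_eq)
qed auto

end

text \<open>The finiteness clause ensures that \<open>num_vertices\<close> is a genuine count and
  not the default value 0 of \<open>card\<close> on infinite sets.\<close>

theorem theorem2:
  fixes A :: "real \<Rightarrow> real^'n^'n" and \<Phi> :: "real \<Rightarrow> real \<Rightarrow> real^'n^'n"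
  assumes "continuous_time_chain A"
    and "state_transition_matrix A \<Phi>"
  shows "\<forall>\<tau>\<ge>0. finite {x. x extreme_point_of limit_polytope \<Phi> \<tau>} \<and>
           chain_rank \<Phi> = num_vertices (limit_polytope \<Phi> \<tau>)"
proof (intro allI impI conjI)
  interpret chain_transition A \<Phi>
    using assms by unfold_locales
  fix \<tau> :: real assume "0 \<le> \<tau>"
  then show "finite {x. x extreme_point_of limit_polytope \<Phi> \<tau>}"
    by (intro finiteI_independent independent_vertices)
  show "chain_rank \<Phi> = num_vertices (limit_polytope \<Phi> \<tau>)"
    using dim_null_space_at[OF \<open>0 \<le> \<tau>\<close>] dim_null_space_at_eq[OF \<open>0 \<le> \<tau>\<close>]
    by (simp add: chain_rank_def chain_nullity_eq num_vertices_def)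
qed

end
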